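(* Let $m \ge 2$, $n\ge 1$ be integers, let $\mathcal{F}=\{f_1,\dots,f_m\}$ be a set of methods, $\mathcal{X}=\{x_1,\dots,x_n\}$ a set of examples, and let $S\in[0,1]^{m\times n}$, $S_{ij}=s(f_i(x_j))$, be the (fixed, deterministic) scoring matrix. Let $\mu_i=\frac1n\sum_{j=1}^n S_{ij}$ for $i\in\{1,\dots,m\}$, suppose that the maximizer $i^*=\arg\max_i \mu_i$ is unique, and define $$H_1=\sum_{i=1,\, i\neq i^*}^m \frac{1}{(\mu_i-\mu_{i^*})^2}.$$ Let $T$ be an integer with $m\le T\le mn$ (the evaluation budget), and let the exploration parameter be $a=\frac{25}{36}\cdot\frac{T-m}{H_1}$. Then the output $\mathcal{A}_{\rm ue}(T,\mathcal{F},\mathcal{X};a)\in\{1,\dots,m\}$ of the UCB-E algorithm (defined in the context) satisfies $$\mathbb{P}_{\mathcal{A}_{\rm ue}}\big(\mathcal{A}_{\rm ue}(T,\mathcal{F},\mathcal{X};a)=i^*\big)\;\ge\; 1-2Tm\exp\left(-\frac{T-m}{18H_1}\right),$$ where the probability is over the internal randomness of the algorithm.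
   Context: The problem: an algorithm may query entries of an unknown fixed matrix $S\in[0,1]^{m\times n}$, one entry per round, for $T$ rounds; rows are methods $f_i$, columns are examples $x_j$, and evaluating the pair $(f_i,x_j)$ reveals $S_{ij}=s(f_i(x_j))$, where $s$ is a scoring function with values in $[0,1]$. The goal is to output the index $i^*$ of the row with the largest mean $\mu_i$. The algorithm UCB-E, denoted $\mathcal{A}_{\rm ue}(T,\mathcal{F},\mathcal{X};a)$, with exploration parameter $a\ge 0$, is as follows. It maintains an observation matrix $O\in\{0,1\}^{m\times n}$ ($O_{ij}=1$ iff the pair $(f_i,x_j)$ has been evaluated), initially all zeros; a partially observed scoring matrix $S^{\rm obs}$, with $S^{\rm obs}_{ij}=S_{ij}$ whenever $O_{ij}=1$ and $S^{\rm obs}_{ij}$ unknown otherwise (terms with $O_{ij}=0$ contribute $0$ to the sums below); and upper confidence bounds $B_1,\dots,B_m$, initially all $+\infty$. For each $t=1,\dots,T$: (1) Select: choose $i\in\arg\max\{B_k : k\in\{1,\dots,m\},\ \sum_{j=1}^n O_{kj}\neq n\}$ (a row that is not yet fully observed and has maximal bound), ties being resolved uniformly at random; then draw $j$ uniformly at random from $\{k\in\{1,\dots,n\} : O_{ik}=0\}$ (so examples for each row are sampled without replacement). (2) Evaluate: observe $S_{ij}$ and set $S^{\rm obs}_{ij}\leftarrow S_{ij}$. (3) Update: set $O_{ij}\leftarrow 1$ and, for the selected row $i$, $$B_i\leftarrow \frac{\sum_{l=1}^n O_{il}S^{\rm obs}_{il}}{\sum_{l=1}^n O_{il}}+\sqrt{\frac{a}{\sum_{l=1}^n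 O_{il}}}.$$ After round $T$ the algorithm returns $$\hat{i}^*\in\arg\max_{i}\frac{\sum_{j=1}^n O_{ij}S^{\rm obs}_{ij}}{\sum_{j=1}^n O_{ij}},$$ with ties in this last maximization broken arbitrarily. *)

theory Defs
  imports "HOL-Probability.Probability"
begin

(* Rows (methods) are indexed by {1..m}, columns (examples) by {1..n};
   values of S outside these index ranges are never used. *)

definition row_mean :: "(nat \<Rightarrow> nat \<Rightarrow> real) \<Rightarrow> nat \<Rightarrow> nat \<Rightarrow> real" where
  "row_mean S n i = (\<Sum>j=1..n. S i j) / real n"

definition hardness :: "(nat \<Rightarrow> nat \<Rightarrow> real) \<Rightarrow> nat \<Rightarrow> nat \<Rightarrow> nat \<Rightarrow> real" where
  "hardness S m n istar =
     (\<Sum>i\<in>{1..m} - {istar}. 1 / (row_mean S n i - row_mean S n istar)\<^sup>2)"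

(* obs is the 0/1 observation matrix.  An entry of sobs is meaningful only where obs is 1:
   every use below is weighted by obs, so the initial value of an unobserved entry is
   irrelevant. *)
record ucbe_state =
  obs :: "nat \<Rightarrow> nat \<Rightarrow> nat"
  sobs :: "nat \<Rightarrow> nat \<Rightarrow> real"
  bound :: "nat \<Rightarrow> ereal"

definition ucbe_init :: ucbe_state where
  "ucbe_init = \<lparr>obs = (\<lambda>_ _. 0), sobs = (\<lambda>_ _. 0), bound = (\<lambda>_. \<infinity>)\<rparr>"

definition obs_count :: "nat \<Rightarrow> ucbe_state \<Rightarrow> nat \<Rightarrow> nat" where
  "obs_count n st i = (\<Sum>l=1..n. obs st i l)"

(* 0 for a row without observations (division by zero); after at least m rounds every row
   has been observed, because unobserved rows have bound \<infinity>. *)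
definition obs_mean :: "nat \<Rightarrow> ucbe_state \<Rightarrow> nat \<Rightarrow> real" where
  "obs_mean n st i = (\<Sum>l=1..n. real (obs st i l) * sobs st i l) / real (obs_count n st i)"

definition ucbe_candidates :: "nat \<Rightarrow> nat \<Rightarrow> ucbe_state \<Rightarrow> nat set" where
  "ucbe_candidates m n st =
     {i. is_arg_max (bound st) (\<lambda>k. k \<in> {1..m} \<and> obs_count n st k \<noteq> n) i}"

definition ucbe_observe :: "nat \<Rightarrow> nat \<Rightarrow> real \<Rightarrow> ucbe_state \<Rightarrow> ucbe_state" where
  "ucbe_observe i j v st =
     st\<lparr>obs := (obs st)(i := (obs st i)(j := 1)),
        sobs := (sobs st)(i := (sobs st i)(j := v))\<rparr>"

definition ucbe_update_bound :: "real \<Rightarrow> nat \<Rightarrow> nat \<Rightarrow> ucbe_state \<Rightarrow> ucbe_state" where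
  "ucbe_update_bound a n i st =
     st\<lparr>bound := (bound st)(i :=
          ereal (obs_mean n st i + sqrt (a / real (obs_count n st i))))\<rparr>"

definition ucbe_step ::
  "(nat \<Rightarrow> nat \<Rightarrow> real) \<Rightarrow> nat \<Rightarrow> nat \<Rightarrow> real \<Rightarrow> ucbe_state \<Rightarrow> ucbe_state pmf" where
  "ucbe_step S m n a st =
     do {
       i \<leftarrow> pmf_of_set (ucbe_candidates m n st);
       j \<leftarrow> pmf_of_set {k \<in> {1..n}. obs st i k = 0};
       return_pmf (ucbe_update_bound a n i (ucbe_observe i j (S i j) st))
     }"

primrec ucbe_run ::
  "(nat \<Rightarrow> nat \<Rightarrow> real) \<Rightarrow> nat \<Rightarrow> nat \<Rightarrow> real \<Rightarrow> nat \<Rightarrow> ucbe_state pmf" where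
  "ucbe_run S m n a 0 = return_pmf ucbe_init"
| "ucbe_run S m n a (Suc t) = bind_pmf (ucbe_run S m n a t) (ucbe_step S m n a)"

(* A final tie-breaking rule, possibly randomised: on every state it returns a row of
   maximal observed mean. *)
definition ucbe_output_rule :: "nat \<Rightarrow> nat \<Rightarrow> (ucbe_state \<Rightarrow> nat pmf) \<Rightarrow> bool" where
  "ucbe_output_rule m n out \<longleftrightarrow>
     (\<forall>st. set_pmf (out st) \<subseteq> {i. is_arg_max (obs_mean n st) (\<lambda>k. k \<in> {1..m}) i})"

definition ucbe ::
  "(nat \<Rightarrow> nat \<Rightarrow> real) \<Rightarrow> nat \<Rightarrow> nat \<Rightarrow> (ucbe_state \<Rightarrow> nat pmf) \<Rightarrow> nat \<Rightarrow> real \<Rightarrow> nat pmf" where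
  "ucbe S m n out T a = bind_pmf (ucbe_run S m n a T) out"

end

(* For a fixed row and a fixed count c < n, the mean of the first c draws without replacement is
   controlled by an exponential supermartingale in the set A of columns drawn so far, built from the
   martingale (sum over A - |A| mu) / (n - |A|) and Hoeffding's lemma. Summing it over all rows and
   the counts still reachable gives a potential that bounds the probability that some observed mean
   ever deviates from mu_k by more than sqrt (a / count_k) / 5; no coupling with pre-drawn
   permutations is needed.

   As long as no such deviation has occurred, every pull of row k shows that its bound was at least
   that of every row p not yet exhausted. If at the end a row i had an observed mean at least that of
   istar, then i or istar would be pulled so rarely that its bound stayed well above the mean of
   istar, and comparison with this row limits all pull counts to a total below T. *)
theory Submission
  imports Defs
begin

section \<open>Sampling without replacement\<close>

text \<open>Hoeffding's lemma for a uniform draw from \<open>U\<close>, written as a finite average.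
  It is applied for positive \<open>l\<close>; for negative \<open>l\<close>, passing to
  \<open>-l\<close> and the reflected values \<open>1 - x j\<close> leaves every exponent
  unchanged.\<close>

lemma avg_exp_le:
  fixes x :: "'b \<Rightarrow> real" and l :: real
  assumes "finite U" "U \<noteq> {}" and x: "\<And>j. j \<in> U \<Longrightarrow> x j \<in> {0..1}"
  shows "(\<Sum>j\<in>U. exp (l * (x j - (\<Sum>i\<in>U. x i) / card U))) / card U \<le> exp (l\<^sup>2 / 8)"
proof -
  have pos: "(\<Sum>j\<in>U. exp (l * (y j - (\<Sum>i\<in>U. y i) / card U))) / card U \<le> exp (l\<^sup>2 / 8)"
    if "l > 0" and y: "\<And>j. j \<in> U \<Longrightarrow> y j \<in> {0..1}" for l :: real and y :: "'b \<Rightarrow> real"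
  proof -
    interpret interval_bounded_random_variable "measure_pmf (pmf_of_set U)" y 0 1
      by unfold_locales (use assms y in \<open>auto simp: AE_measure_pmf_iff\<close>)
    have "nn_integral (measure_pmf (pmf_of_set U)) (\<lambda>j. exp (l * (y j - measure_pmf.expectation (pmf_of_set U) y)))
            \<le> ennreal (exp (l\<^sup>2 / 8))"
      using Hoeffdings_lemma_nn_integral[OF \<open>l > 0\<close>] by simp
    moreover have "measure_pmf.expectation (pmf_of_set U) y = (\<Sum>i\<in>U. y i) / card U"
      using assms by (simp add: integral_pmf_of_set)
    moreover have "nn_integral (measure_pmf (pmf_of_set U)) (\<lambda>j. exp (l * (y j - (\<Sum>i\<in>U. y i) / card U)))
      = ennreal ((\<Sum>j\<in>U. exp (l * (y j - (\<Sum>i\<in>U. y i) / card U))) / card U)"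
      using assms
      by (subst nn_integral_pmf_of_set)
         (simp_all add: sum_nonneg card_gt_0_iff ennreal_of_nat_eq_real_of_nat divide_ennreal)
    ultimately show ?thesis by simp
  qed
  consider "l > 0" | "l = 0" | "l < 0" by linarith
  then show ?thesis
  proof cases
    case 1
    then show ?thesis using pos x by blast
  next
    case 2
    then show ?thesis using assms by simp
  next
    case 3
    have "card U > 0" using assms by (simp add: card_gt_0_iff)
    then have avg: "(\<Sum>i\<in>U. 1 - x i) / card U = 1 - (\<Sum>i\<in>U. x i) / card U"
      by (simp add: sum_subtractf diff_divide_distrib)
    have flip: "- l * ((1 - x j) - (1 - (\<Sum>i\<in>U. x i) / card U))
      = l * (x j - (\<Sum>i\<in>U. x i) / card U)" for j
      by (simp add: algebra_simps)
    show ?thesis using pos[of "-l" "\<lambda>j. 1 - x j"] 3 x unfolding avg flip by auto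
  qed
qed

section \<open>Exponential potentials for the deviation of one row\<close>

definition dev :: "('b \<Rightarrow> real) \<Rightarrow> 'b set \<Rightarrow> 'b set \<Rightarrow> real" where
  "dev x N A = (\<Sum>j\<in>A. x j) - card A * ((\<Sum>j\<in>N. x j) / card N)"

text \<open>The first summand of the exponent is l times the conditional expectation, given that
  A has been drawn, of the deviation after c draws.\<close>
definition exp_pot :: "('b \<Rightarrow> real) \<Rightarrow> 'b set \<Rightarrow> real \<Rightarrow> nat \<Rightarrow> 'b set \<Rightarrow> real" where
  "exp_pot x N l c A =
     exp (l * dev x N A * (real (card N) - c) / (real (card N) - card A) + l\<^sup>2 * (real c - card A) / 8)"

lemma dev_empty [simp]: "dev x N {} = 0"
  by (simp add: dev_def)

lemma dev_full: "finite N \<Longrightarrow> dev x N N = 0"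
  by (cases "N = {}") (auto simp: dev_def)

lemma dev_insert:
  "finite A \<Longrightarrow> j \<notin> A \<Longrightarrow> dev x N (insert j A) = dev x N A + x j - (\<Sum>j\<in>N. x j) / card N"
  by (simp add: dev_def algebra_simps add_divide_distrib)

text \<open>Supermartingale property: \<open>dev x N A / (card N - card A)\<close> is a martingale
  under uniform draws from the complement. By Hoeffding's lemma one draw costs at most a factor
  \<open>exp (l^2 / 8)\<close>, which the second summand of the exponent releases as
  \<open>card A\<close> grows by one.\<close>

lemma exp_pot_step:
  fixes x :: "'b \<Rightarrow> real"
  assumes fin: "finite N" and sub: "A \<subseteq> N" and c: "card A < c" "c < card N"
    and x: "\<And>j. j \<in> N \<Longrightarrow> x j \<in> {0..1}"
  shows "(\<Sum>j\<in>N - A. exp_pot x N l c (insert j A)) / card (N - A) \<le> exp_pot x N l c A"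
proof -
  define k n where "k = real (card A)" and "n = real (card N)"
  define \<mu> where "\<mu> = (\<Sum>j\<in>N. x j) / n"
  define \<nu> where "\<nu> = (\<Sum>j\<in>N - A. x j) / card (N - A)"
  define h where "h = l * ((n - c) / (n - k - 1))"
  define D where "D = dev x N A"
  have finA: "finite A" using fin sub finite_subset by blast
  have kc: "k + 1 \<le> c" "real c < n" using c by (auto simp: k_def n_def)
  have nk: "n - k > 1" using kc by linarith
  have k0: "k \<ge> 0" by (simp add: k_def)
  have cardU: "real (card (N - A)) = n - k"
    using fin sub finA card_mono[OF fin sub] by (simp add: card_Diff_subset k_def n_def of_nat_diff)
  then have U: "N - A \<noteq> {}" using nk by (metis card.empty not_one_less_zero of_nat_0)
  \<comment> \<open>The deviations from \<mu> over all of \<open>N\<close> sum to zero, so the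
    undrawn columns carry \<open>-D\<close>, spread over \<open>n - k\<close> elements.\<close>
  have nu: "\<nu> = \<mu> - D / (n - k)"
  proof -
    have "(\<Sum>j\<in>N - A. x j) = n * \<mu> - (D + k * \<mu>)"
      using nk k0 fin sub by (simp add: sum_diff D_def dev_def \<mu>_def k_def n_def)
    then have "\<nu> = ((n - k) * \<mu> - D) / (n - k)" by (simp add: \<nu>_def cardU algebra_simps)
    then show ?thesis using nk by (simp add: diff_divide_distrib)
  qed
  have step: "exp_pot x N l c (insert j A)
      = exp (l * D * (n - c) / (n - k) + l\<^sup>2 * (c - k - 1) / 8) * exp (h * (x j - \<nu>))"
    if "j \<in> N - A" for j
  proof -
    have dj: "dev x N (insert j A) = D + x j - \<mu>"
      using that finA by (simp add: dev_insert D_def \<mu>_def n_def)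
    \<comment> \<open>The martingale increment: its average over the undrawn \<open>j\<close>
      vanishes because \<nu> is their mean.\<close>
    have "(D + x j - \<mu>) / (n - k - 1) = D / (n - k) + (x j - \<nu>) / (n - k - 1)"
      using nk unfolding nu by (simp add: divide_simps) (simp add: algebra_simps)
    then have "l * (n - c) * ((D + x j - \<mu>) / (n - k - 1))
        = l * (n - c) * (D / (n - k)) + l * (n - c) * ((x j - \<nu>) / (n - k - 1))"
      by (simp only: distrib_left)
    then have "l * (D + x j - \<mu>) * (n - c) / (n - k - 1)
        = l * D * (n - c) / (n - k) + h * (x j - \<nu>)"
      unfolding h_def by (simp only: times_divide_eq_right times_divide_eq_left mult_ac)
    moreover have "real (card (insert j A)) = k + 1" using that finA by (simp add: k_def)
    ultimately show ?thesis
      by (simp add: exp_pot_def dj n_def[symmetric] exp_add[symmetric] diff_diff_eq)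
  qed
  \<comment> \<open>Since \<open>k + 1 \<le> c < n\<close>, the ratio lies between 0 and 1, so
    Hoeffding's lemma at \<open>h\<close> costs no more than at \<open>l\<close>.\<close>
  have "\<bar>(n - c) / (n - k - 1)\<bar> \<le> 1" using kc nk by (simp add: abs_le_iff divide_simps)
  then have "((n - c) / (n - k - 1))\<^sup>2 \<le> 1" using abs_square_le_1 by blast
  then have h2: "h\<^sup>2 \<le> l\<^sup>2"
    unfolding h_def power_mult_distrib using mult_left_le zero_le_power2 by blast
  have "(\<Sum>j\<in>N - A. exp_pot x N l c (insert j A)) / card (N - A)
      = exp (l * D * (n - c) / (n - k) + l\<^sup>2 * (c - k - 1) / 8)
        * ((\<Sum>j\<in>N - A. exp (h * (x j - \<nu>))) / card (N - A))"
    by (simp add: step sum_distrib_left)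
  also have "\<dots> \<le> exp (l * D * (n - c) / (n - k) + l\<^sup>2 * (c - k - 1) / 8) * exp (h\<^sup>2 / 8)"
    unfolding \<nu>_def using fin U x by (intro mult_left_mono avg_exp_le) auto
  also have "\<dots> \<le> exp (l * D * (n - c) / (n - k) + l\<^sup>2 * (c - k - 1) / 8) * exp (l\<^sup>2 / 8)"
    using h2 by (intro mult_left_mono) auto
  also have "\<dots> = exp_pot x N l c A"
    by (simp add: exp_pot_def exp_add[symmetric] k_def n_def D_def) (simp add: algebra_simps add_divide_distrib diff_divide_distrib)
  finally show ?thesis .
qed

text \<open>Multiplied by \<open>card A\<close> so that the empty set is covered without division.
  For nonempty \<open>A\<close> the mean is within one fifth of the bonus
  \<open>sqrt (a / card A)\<close>.\<close>

definition accurate :: "('b \<Rightarrow> real) \<Rightarrow> 'b set \<Rightarrow> real \<Rightarrow> 'b set \<Rightarrow> bool" where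
  "accurate x N a A \<longleftrightarrow> \<bar>dev x N A\<bar> \<le> sqrt (a * card A) / 5"

text \<open>After c = card N draws the row mean is exact, so no failure has to be paid for.\<close>
definition inacc_pot :: "('b \<Rightarrow> real) \<Rightarrow> 'b set \<Rightarrow> real \<Rightarrow> nat \<Rightarrow> 'b set \<Rightarrow> real" where
  "inacc_pot x N a c A =
     (if c < card N
      then (exp_pot x N (4 / 5 * sqrt (a / c)) c A + exp_pot x N (- (4 / 5 * sqrt (a / c))) c A)
             * exp (- 4 * a / 25)
      else 0)"

lemma inacc_pot_nonneg: "inacc_pot x N a c A \<ge> 0"
  by (simp add: inacc_pot_def exp_pot_def)

lemma inacc_pot_step:
  fixes x :: "'b \<Rightarrow> real"
  assumes "finite N" "A \<subseteq> N" "card A < c" "\<And>j. j \<in> N \<Longrightarrow> x j \<in> {0..1}"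
  shows "(\<Sum>j\<in>N - A. inacc_pot x N a c (insert j A)) / card (N - A) \<le> inacc_pot x N a c A"
proof (cases "c < card N")
  case True
  define l where "l = 4 / 5 * sqrt (a / c)"
  have "(\<Sum>j\<in>N - A. inacc_pot x N a c (insert j A)) / card (N - A)
    = ((\<Sum>j\<in>N - A. exp_pot x N l c (insert j A)) / card (N - A)
       + (\<Sum>j\<in>N - A. exp_pot x N (-l) c (insert j A)) / card (N - A)) * exp (- 4 * a / 25)"
    using True by (simp add: inacc_pot_def l_def sum_distrib_right[symmetric] sum.distrib add_divide_distrib[symmetric])
  also have "\<dots> \<le> (exp_pot x N l c A + exp_pot x N (-l) c A) * exp (- 4 * a / 25)"
    using True assms by (intro mult_right_mono add_mono exp_pot_step) auto
  finally show ?thesis using True by (simp add: inacc_pot_def l_def)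
qed (simp add: inacc_pot_def)

text \<open>Chernoff's argument: when \<open>c\<close> is the current count the exponents reduce to
  \<open>l * dev x N A\<close> and its negative, and a failure pushes one of them beyond
  \<open>4 * a / 25\<close>, the value of \<open>l\<close> times the threshold
  \<open>sqrt (a * c) / 5\<close>.\<close>

lemma inacc_pot_inaccurate:
  assumes fin: "finite N" and sub: "A \<subseteq> N" and a: "a \<ge> 0" and bad: "\<not> accurate x N a A"
  shows "inacc_pot x N a (card A) A \<ge> 1"
proof -
  define c where "c = real (card A)"
  define l where "l = 4 / 5 * sqrt (a / c)"
  \<comment> \<open>The deviation vanishes at both extremes, so a failure happens strictly between
    them, where the nonzero branch of the potential applies.\<close>
  have "A \<noteq> N" using bad a dev_full[OF fin] by (auto simp: accurate_def)
  then have lt: "card A < card N" using fin sub by (simp add: psubset_card_mono psubsetI)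
  have "A \<noteq> {}" using bad by (auto simp: accurate_def)
  then have c: "c > 0" using finite_subset[OF sub fin] by (simp add: c_def card_gt_0_iff)
  have l0: "l \<ge> 0" using a c by (simp add: l_def)
  have "sqrt (a / c) * sqrt (a * c) = a"
    using a c by (simp add: real_sqrt_mult[symmetric])
  then have "l * (sqrt (a * c) / 5) = 4 * a / 25" by (simp add: l_def)
  moreover have "l * (sqrt (a * c) / 5) \<le> l * \<bar>dev x N A\<bar>"
    using bad l0 by (intro mult_left_mono) (auto simp: accurate_def c_def)
  ultimately have ge: "4 * a / 25 \<le> l * \<bar>dev x N A\<bar>" by simp
  have "1 \<le> exp (l * \<bar>dev x N A\<bar> - 4 * a / 25)" using ge by simp
  also have "\<dots> = exp (l * \<bar>dev x N A\<bar>) * exp (- 4 * a / 25)"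
    by (simp add: exp_add[symmetric])
  also have "exp (l * \<bar>dev x N A\<bar>) \<le> exp (l * dev x N A) + exp (- l * dev x N A)"
    by (cases "dev x N A \<ge> 0") (auto simp: add_increasing add_increasing2)
  finally have "1 \<le> (exp (l * dev x N A) + exp (- l * dev x N A)) * exp (- 4 * a / 25)" by simp
  moreover have "exp (l * dev x N A) = exp_pot x N l (card A) A"
      "exp (- l * dev x N A) = exp_pot x N (- l) (card A) A"
    using lt by (simp_all add: exp_pot_def)
  ultimately show ?thesis
    using lt unfolding l_def c_def by (simp add: inacc_pot_def)
qed

text \<open>The choice \<open>l = 4 / 5 * sqrt (a / c)\<close> minimises
  \<open>l^2 * c / 8 - l * sqrt (a * c) / 5\<close>, and the minimum is
  \<open>2 * a / 25 - 4 * a / 25\<close>. The factor 2 counts the two tails.\<close>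

lemma inacc_pot_empty:
  assumes a: "a \<ge> 0" and c: "c > 0"
  shows "inacc_pot x N a c {} \<le> 2 * exp (- 2 * a / 25)"
proof -
  have "(4 / 5 * sqrt (a / c))\<^sup>2 * c / 8 = 2 * a / 25"
    using a c by (simp add: power_mult_distrib power2_eq_square)
  then have "exp_pot x N (4 / 5 * sqrt (a / c)) c {} = exp (2 * a / 25)"
    "exp_pot x N (- (4 / 5 * sqrt (a / c))) c {} = exp (2 * a / 25)"
    by (simp_all add: exp_pot_def)
  moreover have "exp (2 * a / 25) * exp (- 4 * a / 25) = exp (- 2 * a / 25)"
    by (simp add: exp_add[symmetric])
  ultimately show ?thesis unfolding inacc_pot_def by simp
qed

section \<open>Union bound over the counts that one row can still reach\<close>

definition row_pot :: "('b \<Rightarrow> real) \<Rightarrow> 'b set \<Rightarrow> real \<Rightarrow> nat \<Rightarrow> 'b set \<Rightarrow> real" where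
  "row_pot x N a t A = (\<Sum>c\<in>{card A<..card A + t}. inacc_pot x N a c A)"

lemma row_pot_nonneg: "row_pot x N a t A \<ge> 0"
  by (simp add: row_pot_def sum_nonneg inacc_pot_nonneg)

lemma row_pot_mono: "t \<le> t' \<Longrightarrow> row_pot x N a t A \<le> row_pot x N a t' A"
  unfolding row_pot_def by (rule sum_mono2) (auto simp: inacc_pot_nonneg)

text \<open>The draw moves the row to count \<open>card A + 1\<close>. The summand for this count
  pays for a failure there, and the later summands form the potential of the new set; each summand
  does not increase on average. The count \<open>card A\<close> itself is excluded from the
  potential because it has been passed already.\<close>

lemma row_pot_step:
  fixes x :: "'b \<Rightarrow> real"
  assumes fin: "finite N" and sub: "A \<subseteq> N" and a: "a \<ge> 0" and x: "\<And>j. j \<in> N \<Longrightarrow> x j \<in> {0..1}"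
  shows "(\<Sum>j\<in>N - A. of_bool (\<not> accurate x N a (insert j A)) + row_pot x N a t (insert j A))
           / card (N - A) \<le> row_pot x N a (Suc t) A"
proof -
  have finA: "finite A" using fin sub finite_subset by blast
  have one: "of_bool (\<not> accurate x N a (insert j A)) + row_pot x N a t (insert j A)
      \<le> (\<Sum>c\<in>{card A<..card A + Suc t}. inacc_pot x N a c (insert j A))" if j: "j \<in> N - A" for j
  proof -
    have card: "card (insert j A) = Suc (card A)" using j finA by simp
    have "of_bool (\<not> accurate x N a (insert j A)) \<le> inacc_pot x N a (Suc (card A)) (insert j A)"
      using inacc_pot_inaccurate[OF fin _ a, of "insert j A" x] inacc_pot_nonneg[of x N a "Suc (card A)" "insert j A"] j sub card
      by (cases "accurate x N a (insert j A)") auto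
    moreover have "{card A<..card A + Suc t} = insert (Suc (card A)) {Suc (card A)<..Suc (card A) + t}"
      by auto
    ultimately show ?thesis by (simp add: row_pot_def card)
  qed
  have "(\<Sum>j\<in>N - A. of_bool (\<not> accurate x N a (insert j A)) + row_pot x N a t (insert j A)) / card (N - A)
     \<le> (\<Sum>j\<in>N - A. \<Sum>c\<in>{card A<..card A + Suc t}. inacc_pot x N a c (insert j A)) / card (N - A)"
    by (intro divide_right_mono sum_mono one) auto
  also have "\<dots> = (\<Sum>c\<in>{card A<..card A + Suc t}. (\<Sum>j\<in>N - A. inacc_pot x N a c (insert j A)) / card (N - A))"
    by (subst sum.swap) (simp add: sum_divide_distrib)
  also have "\<dots> \<le> row_pot x N a (Suc t) A"
    unfolding row_pot_def using assms by (intro sum_mono inacc_pot_step) auto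
  finally show ?thesis .
qed

lemma row_pot_empty:
  "a \<ge> 0 \<Longrightarrow> row_pot x N a t {} \<le> t * (2 * exp (- 2 * a / 25))"
  unfolding row_pot_def
  by (rule order_trans[OF sum_bounded_above[where K = "2 * exp (- 2 * a / 25)"]])
     (auto intro: inacc_pot_empty[simplified])

section \<open>Counting pulls\<close>

text \<open>Here \<open>c - 1\<close> stands for the count just before the last pull, when the
  comparison was made. For \<open>c = 1\<close> there is no comparison to use, but the left side is
  zero.\<close>

lemma pulls_bound:
  fixes a e :: real
  assumes a: "a \<ge> 0" and e: "e > 0" and c: "c \<ge> 1"
    and le: "c \<ge> 2 \<Longrightarrow> e \<le> 6 / 5 * sqrt (a / (real c - 1))"
  shows "real c - 1 \<le> 36 / 25 * (a / e\<^sup>2)"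
proof (cases "c \<ge> 2")
  case True
  have "e\<^sup>2 \<le> (6 / 5 * sqrt (a / (real c - 1)))\<^sup>2"
    using le[OF True] e by (intro power_mono) auto
  also have "\<dots> = 36 / 25 * (a / (real c - 1))"
    using a True by (simp add: power_mult_distrib power2_eq_square)
  finally have "e\<^sup>2 * (real c - 1) \<le> 36 / 25 * a"
    using True by (simp add: field_simps)
  then show ?thesis using e by (simp add: field_simps)
next
  case False
  then have "c = 1" using c by simp
  then show ?thesis using a by simp
qed

lemma sqrt_pulls_bound:
  fixes a e :: real
  assumes a: "a \<ge> 0" and e: "e > 0" and c: "c \<ge> 1" and le: "e \<le> sqrt (a / real c)"
  shows "real c \<le> a / e\<^sup>2"
proof -
  have "e\<^sup>2 \<le> (sqrt (a / real c))\<^sup>2" using le e by (intro power_mono) auto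
  then have "e\<^sup>2 \<le> a / c" using a by simp
  then show ?thesis using c e by (simp add: field_simps)
qed

text \<open>The deterministic core. If \<open>i\<close> looked at least as good as \<open>s\<close>,
  the radii of the two rows would have to bridge the gap \<open>d i\<close>, so one of the two has
  few pulls and a large bonus. Comparing all rows with that row caps the counts: each other row
  keeps to its share \<open>36 / 25 * w k\<close> of the budget, while \<open>i\<close> and
  \<open>s\<close> together use less than the share of \<open>i\<close>, so the budget is not
  spent.\<close>

lemma best_arm_wins:
  fixes a :: real and \<mu> \<mu>h :: "nat \<Rightarrow> real" and c :: "nat \<Rightarrow> nat"
  assumes fin: "finite K" and s: "s \<in> K" and i: "i \<in> K" "i \<noteq> s"
    and best: "\<And>k. k \<in> K \<Longrightarrow> k \<noteq> s \<Longrightarrow> \<mu> k < \<mu> s"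
    and a: "a > 0" and c: "\<And>k. k \<in> K \<Longrightarrow> c k \<ge> 1"
    and comp: "\<And>k p. k \<in> K \<Longrightarrow> p \<in> K \<Longrightarrow> k \<noteq> p \<Longrightarrow> c p \<noteq> n \<Longrightarrow> c k \<ge> 2 \<Longrightarrow>
      \<mu> p + 4 / 5 * sqrt (a / c p) \<le> \<mu> k + 6 / 5 * sqrt (a / (real (c k) - 1))"
    and acc: "\<And>k. k \<in> K \<Longrightarrow> \<bar>\<mu>h k - \<mu> k\<bar> \<le> 1 / 5 * sqrt (a / c k)"
    and full: "\<And>k. k \<in> K \<Longrightarrow> c k = n \<Longrightarrow> \<mu>h k = \<mu> k"
    and budget: "36 / 25 * a * (\<Sum>k\<in>K - {s}. 1 / (\<mu> k - \<mu> s)\<^sup>2) \<le> (\<Sum>k\<in>K. real (c k) - 1)"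
  shows "\<mu>h i < \<mu>h s"
proof (rule ccontr)
  assume "\<not> \<mu>h i < \<mu>h s"
  define d where "d k = \<mu> s - \<mu> k" for k
  \<comment> \<open>The number of pulls at which the bonus has shrunk to the gap
    \<open>d k\<close>.\<close>
  define w where "w k = a / (d k)\<^sup>2" for k
  have dpos: "d k > 0" if "k \<in> K" "k \<noteq> s" for k using best that by (simp add: d_def)
  have di: "d i > 0" using dpos i by blast
  have wi: "w i > 0" using di a by (simp add: w_def)
  have split: "(\<Sum>k\<in>K. f k) = f s + (f i + (\<Sum>k\<in>K - {s} - {i}. f k))" for f :: "nat \<Rightarrow> real"
    using fin s i by (simp add: sum.remove[of K s] sum.remove[of "K - {s}" i])
  have split': "(\<Sum>k\<in>K - {s}. f k) = f i + (\<Sum>k\<in>K - {s} - {i}. f k)" for f :: "nat \<Rightarrow> real"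
    using fin s i by (simp add: sum.remove[of "K - {s}" i])
  have "36 / 25 * a * (\<Sum>k\<in>K - {s}. 1 / (\<mu> k - \<mu> s)\<^sup>2) = (\<Sum>k\<in>K - {s}. 36 / 25 * w k)"
    by (simp add: sum_distrib_left w_def d_def power2_commute)
  \<comment> \<open>The left side has no share for \<open>s\<close>, so a contradiction requires the
    pulls of both \<open>s\<close> and \<open>i\<close> to fit below
    \<open>36 / 25 * w i\<close>.\<close>
  then have B: "36 / 25 * w i + (\<Sum>k\<in>K - {s} - {i}. 36 / 25 * w k)
      \<le> (real (c s) - 1) + ((real (c i) - 1) + (\<Sum>k\<in>K - {s} - {i}. real (c k) - 1))"
    using budget split'[of "\<lambda>k. 36 / 25 * w k"] split[of "\<lambda>k. real (c k) - 1"] by linarith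
  \<comment> \<open>\<open>p\<close> is the rarely pulled row and \<open>e\<close> the margin by
    which its level exceeds the mean of \<open>s\<close>; a row \<open>k\<close> then competes
    against a gap of \<open>d k + e\<close>.\<close>
  have pulls: "real (c k) - 1 \<le> 36 / 25 * (a / (d k + e)\<^sup>2)"
    if "p \<in> K" "c p \<noteq> n" "\<mu> s + e \<le> \<mu> p + 4 / 5 * sqrt (a / c p)" "k \<in> K" "k \<noteq> p" "d k + e > 0" for k p e
  proof (rule pulls_bound)
    assume "2 \<le> c k"
    then show "d k + e \<le> 6 / 5 * sqrt (a / (real (c k) - 1))"
      using comp[of k p] that by (simp add: d_def)
  qed (use a c that in auto)
  have rest: "(\<Sum>k\<in>K - {s} - {i}. real (c k) - 1) \<le> (\<Sum>k\<in>K - {s} - {i}. 36 / 25 * w k)"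
    if "p = s \<or> p = i" "c p \<noteq> n" "\<mu> s + e \<le> \<mu> p + 4 / 5 * sqrt (a / c p)" "e \<ge> 0" for p e
  proof (rule sum_mono)
    fix k assume k: "k \<in> K - {s} - {i}"
    then have dk: "d k > 0" using dpos by blast
    have "real (c k) - 1 \<le> 36 / 25 * (a / (d k + e)\<^sup>2)"
      using that k s i dk by (intro pulls[of p]) auto
    also have "a / (d k + e)\<^sup>2 \<le> w k"
      unfolding w_def using a dk \<open>e \<ge> 0\<close> by (intro divide_left_mono power_mono) auto
    finally show "real (c k) - 1 \<le> 36 / 25 * w k" by simp
  qed
  define r where "r k = 1 / 5 * sqrt (a / c k)" for k
  have bonus: "4 / 5 * sqrt (a / c k) = 4 * r k" for k by (simp add: r_def)
  have lo: "\<mu>h s \<ge> \<mu> s - r s" and hi: "\<mu>h i \<le> \<mu> i + r i"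
    using acc[OF s] acc[OF i(1)] unfolding r_def[symmetric] abs_le_iff by linarith+
  have ge: "\<mu>h i \<ge> \<mu>h s" using \<open>\<not> \<mu>h i < \<mu>h s\<close> by simp
  \<comment> \<open>The radii sum to at least \<open>d i\<close>, which is split as 3/5 plus 2/5. An
    exhausted row has radius zero in effect, its mean being exact, and then the other row bears the
    whole gap.\<close>
  have "(c i \<noteq> n \<and> r i \<ge> 3 / 5 * d i) \<or> (c s \<noteq> n \<and> r s \<ge> 2 / 5 * d i)"
    using lo hi ge di full[OF s] full[OF i(1)] unfolding d_def
    by (cases "c i = n"; cases "c s = n") (simp_all, linarith+)
  then show False
  proof (elim disjE conjE)
    assume ci: "c i \<noteq> n" and ge: "r i \<ge> 3 / 5 * d i"
    \<comment> \<open>Four radii of \<open>3 / 5 * d i\<close> give \<open>12 / 5 * d i\<close>, of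
      which one \<open>d i\<close> is spent on climbing from the mean of \<open>i\<close> to that of
      \<open>s\<close>.\<close>
    have b: "\<mu> s + 7 / 5 * d i \<le> \<mu> i + 4 / 5 * sqrt (a / c i)" using ge unfolding bonus d_def by (simp add: field_simps)
    have "real (c i) \<le> a / (3 * d i)\<^sup>2" using ge di a c i by (intro sqrt_pulls_bound) (auto simp: r_def)
    then have 1: "real (c i) \<le> 1 / 9 * w i" by (simp add: w_def power_mult_distrib)
    have "real (c s) - 1 \<le> 36 / 25 * (a / (d s + 7 / 5 * d i)\<^sup>2)"
      using ci b s i di by (intro pulls[of i]) (auto simp: d_def)
    also have "d s + 7 / 5 * d i = 7 / 5 * d i" by (simp add: d_def)
    finally have 2: "real (c s) - 1 \<le> 36 / 49 * w i" by (simp add: w_def power_mult_distrib power_divide)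
    have "(\<Sum>k\<in>K - {s} - {i}. real (c k) - 1) \<le> (\<Sum>k\<in>K - {s} - {i}. 36 / 25 * w k)"
      using ci b di by (intro rest[of i "7 / 5 * d i"]) auto
    \<comment> \<open>\<open>1 / 9 + 36 / 49 < 36 / 25\<close>; in the other case the shares are
      \<open>1 / 4 + 36 / 169\<close>.\<close>
    then show False using B 1 2 wi by linarith
  next
    assume cs: "c s \<noteq> n" and ge: "r s \<ge> 2 / 5 * d i"
    have b: "\<mu> s + 8 / 5 * d i \<le> \<mu> s + 4 / 5 * sqrt (a / c s)" using ge unfolding bonus by simp
    have "real (c s) \<le> a / (2 * d i)\<^sup>2" using ge di a c s by (intro sqrt_pulls_bound) (auto simp: r_def)
    then have 1: "real (c s) \<le> 1 / 4 * w i" by (simp add: w_def power_mult_distrib)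
    have "real (c i) - 1 \<le> 36 / 25 * (a / (d i + 8 / 5 * d i)\<^sup>2)"
      using cs b s i di by (intro pulls[of s]) auto
    also have "d i + 8 / 5 * d i = 13 / 5 * d i" by simp
    finally have 2: "real (c i) - 1 \<le> 36 / 169 * w i" by (simp add: w_def power_mult_distrib power_divide)
    have "(\<Sum>k\<in>K - {s} - {i}. real (c k) - 1) \<le> (\<Sum>k\<in>K - {s} - {i}. 36 / 25 * w k)"
      using cs b di by (intro rest[of s "8 / 5 * d i"]) auto
    then show False using B 1 2 wi by linarith
  qed
qed

section \<open>Runs of UCB-E\<close>

lemma prob_bind_pmf_le:
  assumes "\<And>x. x \<in> set_pmf p \<Longrightarrow> measure_pmf.prob (f x) A \<le> C"
  shows "measure_pmf.prob (bind_pmf p f) A \<le> C"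
proof -
  obtain x where "x \<in> set_pmf p" using set_pmf_not_empty[of p] by blast
  then have C: "C \<ge> 0" using assms[of x] measure_nonneg[of "measure_pmf (f x)" A] by linarith
  have "emeasure (measure_pmf (bind_pmf p f)) A \<le> (\<integral>\<^sup>+x. ennreal C \<partial>measure_pmf p)"
    unfolding emeasure_bind_pmf
    by (rule nn_integral_mono_AE)
       (use assms in \<open>auto simp: AE_measure_pmf_iff measure_pmf.emeasure_eq_measure ennreal_leI\<close>)
  then show ?thesis using C by (simp add: measure_pmf.emeasure_eq_measure)
qed

lemma prob_bind_pmf_le_prob:
  assumes "\<And>x. x \<in> set_pmf p \<Longrightarrow> x \<notin> B \<Longrightarrow> measure_pmf.prob (f x) A = 0"
  shows "measure_pmf.prob (bind_pmf p f) A \<le> measure_pmf.prob p B"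
proof -
  have "emeasure (measure_pmf (bind_pmf p f)) A \<le> (\<integral>\<^sup>+x. indicator B x \<partial>measure_pmf p)"
    unfolding emeasure_bind_pmf
    by (rule nn_integral_mono_AE)
       (use assms in \<open>auto simp: AE_measure_pmf_iff measure_pmf.emeasure_eq_measure indicator_def\<close>)
  then show ?thesis by (simp add: measure_pmf.emeasure_eq_measure)
qed

lemma prob_bind_pmf_of_set:
  assumes "finite U" "U \<noteq> {}"
  shows "measure_pmf.prob (bind_pmf (pmf_of_set U) f) A
           = (\<Sum>j\<in>U. measure_pmf.prob (f j) A) / card U"
proof -
  have "emeasure (measure_pmf (bind_pmf (pmf_of_set U) f)) A
      = ennreal ((\<Sum>j\<in>U. measure_pmf.prob (f j) A) / card U)"
    using assms unfolding emeasure_bind_pmf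
    by (subst nn_integral_pmf_of_set)
       (simp_all add: measure_pmf.emeasure_eq_measure sum_nonneg card_gt_0_iff
          ennreal_of_nat_eq_real_of_nat divide_ennreal)
  then show ?thesis
    by (simp add: measure_pmf.emeasure_eq_measure sum_nonneg)
qed

section \<open>Invariants of the algorithm's state\<close>

definition seen :: "nat \<Rightarrow> ucbe_state \<Rightarrow> nat \<Rightarrow> nat set" where
  "seen n st i = {l \<in> {1..n}. obs st i l = 1}"

abbreviation ucbe_next ::
  "(nat \<Rightarrow> nat \<Rightarrow> real) \<Rightarrow> nat \<Rightarrow> real \<Rightarrow> nat \<Rightarrow> nat \<Rightarrow> ucbe_state \<Rightarrow> ucbe_state" where
  "ucbe_next S n a i j st \<equiv> ucbe_update_bound a n i (ucbe_observe i j (S i j) st)"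

text \<open>Makes counts, observed means and bounds functions of the sets
  \<open>seen n st i\<close>, so that the results on sampling apply to states. An infinite bound
  marks exactly the unobserved rows.\<close>

definition consistent :: "(nat \<Rightarrow> nat \<Rightarrow> real) \<Rightarrow> nat \<Rightarrow> real \<Rightarrow> ucbe_state \<Rightarrow> bool" where
  "consistent S n a st \<longleftrightarrow>
     (\<forall>i l. obs st i l \<in> {0, 1}) \<and> (\<forall>i l. obs st i l = 1 \<longrightarrow> sobs st i l = S i l) \<and>
     (\<forall>i. bound st i = (if obs_count n st i = 0 then \<infinity>
            else ereal (obs_mean n st i + sqrt (a / obs_count n st i))))"

lemma finite_seen [simp]: "finite (seen n st i)"
  by (simp add: seen_def)

lemma seen_subset: "seen n st i \<subseteq> {1..n}"
  by (auto simp: seen_def)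

lemma obs_count_eq_card:
  assumes "consistent S n a st"
  shows "obs_count n st i = card (seen n st i)"
proof -
  have "obs_count n st i = (\<Sum>l\<in>{1..n}. if obs st i l = 1 then 1 else 0)"
    unfolding obs_count_def using assms
    by (intro sum.cong) (auto simp: consistent_def)
  also have "\<dots> = card (seen n st i)"
    by (simp add: seen_def sum.If_cases Int_def)
  finally show ?thesis .
qed

lemma obs_mean_eq:
  assumes "consistent S n a st"
  shows "obs_mean n st i = (\<Sum>l\<in>seen n st i. S i l) / card (seen n st i)"
proof -
  have "(\<Sum>l=1..n. real (obs st i l) * sobs st i l) = (\<Sum>l\<in>seen n st i. real (obs st i l) * sobs st i l)"
    using assms by (intro sum.mono_neutral_right) (auto simp: seen_def consistent_def, force)
  also have "\<dots> = (\<Sum>l\<in>seen n st i. S i l)"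
    using assms by (intro sum.cong) (auto simp: seen_def consistent_def)
  finally show ?thesis by (simp add: obs_mean_def obs_count_eq_card[OF assms])
qed

lemma unseen_eq: "consistent S n a st \<Longrightarrow> {l \<in> {1..n}. obs st i l = 0} = {1..n} - seen n st i"
  by (force simp: seen_def consistent_def)

lemma seen_next:
  assumes "j \<in> {1..n}"
  shows "seen n (ucbe_next S n a i j st) k = (if k = i then insert j (seen n st i) else seen n st k)"
  using assms by (auto simp: seen_def ucbe_update_bound_def ucbe_observe_def)

lemma consistent_next:
  assumes st: "consistent S n a st" and j: "j \<in> {1..n}"
  shows "consistent S n a (ucbe_next S n a i j st)"
proof -
  let ?o = "ucbe_observe i j (S i j) st"
  let ?u = "ucbe_next S n a i j st"
  have count: "obs_count n ?u k = obs_count n ?o k" and mean: "obs_mean n ?u k = obs_mean n ?o k" for k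
    by (simp_all add: obs_count_def obs_mean_def ucbe_update_bound_def)
  have other: "obs_count n ?o k = obs_count n st k" "obs_mean n ?o k = obs_mean n st k" if "k \<noteq> i" for k
    using that by (simp_all add: obs_count_def obs_mean_def ucbe_observe_def)
  have "1 \<le> obs ?o i j" by (simp add: ucbe_observe_def)
  also have "\<dots> \<le> obs_count n ?o i"
    unfolding obs_count_def using j by (intro member_le_sum) auto
  finally have pos: "obs_count n ?o i \<noteq> 0" by simp
  have "bound ?u k = (if obs_count n ?u k = 0 then \<infinity>
            else ereal (obs_mean n ?u k + sqrt (a / obs_count n ?u k)))" for k
  proof (cases "k = i")
    case True
    then show ?thesis using pos by (simp add: count mean) (simp add: ucbe_update_bound_def)
  next
    case False
    then have "bound ?u k = bound st k" by (simp add: ucbe_update_bound_def ucbe_observe_def)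
    then show ?thesis using st False by (simp add: count mean other consistent_def)
  qed
  moreover have "\<forall>k l. obs ?u k l \<in> {0, 1}" "\<forall>k l. obs ?u k l = 1 \<longrightarrow> sobs ?u k l = S k l"
    using st by (auto simp: consistent_def ucbe_update_bound_def ucbe_observe_def)
  ultimately show ?thesis unfolding consistent_def by blast
qed

lemma obs_count_next:
  assumes st: "consistent S n a st" and j: "j \<in> {1..n} - seen n st i"
  shows "obs_count n (ucbe_next S n a i j st) k = (if k = i then Suc (obs_count n st i) else obs_count n st k)"
  using j consistent_next[OF st, of j i] st
  by (simp add: obs_count_eq_card[of S n a] seen_next)

definition accurate_state :: "(nat \<Rightarrow> nat \<Rightarrow> real) \<Rightarrow> nat \<Rightarrow> nat \<Rightarrow> real \<Rightarrow> ucbe_state \<Rightarrow> bool" where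
  "accurate_state S m n a st \<longleftrightarrow> (\<forall>k\<in>{1..m}. accurate (S k) {1..n} a (seen n st k))"

lemma obs_mean_accurate:
  assumes st: "consistent S n a st" and acc: "accurate_state S m n a st"
    and k: "k \<in> {1..m}" and pos: "obs_count n st k \<ge> 1" and a: "a \<ge> 0"
  shows "\<bar>obs_mean n st k - row_mean S n k\<bar> \<le> 1 / 5 * sqrt (a / obs_count n st k)"
proof -
  define c where "c = real (obs_count n st k)"
  have c: "c > 0" using pos by (simp add: c_def)
  have "dev (S k) {1..n} (seen n st k) = c * (obs_mean n st k - row_mean S n k)"
    using c by (simp add: dev_def obs_mean_eq[OF st] row_mean_def c_def obs_count_eq_card[OF st]
        right_diff_distrib)
  moreover have "\<bar>dev (S k) {1..n} (seen n st k)\<bar> \<le> sqrt (a * c) / 5"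
    using acc k unfolding accurate_state_def accurate_def c_def obs_count_eq_card[OF st] by blast
  ultimately have "c * \<bar>obs_mean n st k - row_mean S n k\<bar> \<le> sqrt (a * c) / 5"
    using c by (simp add: abs_mult)
  also have "sqrt (a * c) = c * sqrt (a / c)"
    using c a by (simp add: real_sqrt_mult real_sqrt_divide real_div_sqrt field_simps)
  finally show ?thesis using c by (simp add: c_def)
qed

text \<open>The trace left by the last pull of \<open>k\<close>: its count was then one less and its
  bound at least that of \<open>p\<close>. Replacing observed by true means costs one fifth of each
  bonus, which leaves 4/5 and 6/5. From the second pull on, the bound of \<open>k\<close> was finite
  beforehand, which forces \<open>p\<close> to have been observed.\<close>

definition balanced :: "(nat \<Rightarrow> nat \<Rightarrow> real) \<Rightarrow> nat \<Rightarrow> nat \<Rightarrow> real \<Rightarrow> ucbe_state \<Rightarrow> bool" where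
  "balanced S m n a st \<longleftrightarrow>
     (\<forall>k\<in>{1..m}. \<forall>p\<in>{1..m}. k \<noteq> p \<longrightarrow> obs_count n st p \<noteq> n \<longrightarrow> obs_count n st k \<ge> 2 \<longrightarrow>
        obs_count n st p \<ge> 1 \<and>
        row_mean S n p + 4 / 5 * sqrt (a / obs_count n st p)
          \<le> row_mean S n k + 6 / 5 * sqrt (a / (real (obs_count n st k) - 1)))"

lemma candidate_iff:
  "i \<in> ucbe_candidates m n st \<longleftrightarrow>
     i \<in> {1..m} \<and> obs_count n st i \<noteq> n \<and>
     (\<forall>k\<in>{1..m}. obs_count n st k \<noteq> n \<longrightarrow> bound st k \<le> bound st i)"
  by (auto simp: ucbe_candidates_def is_arg_max_linorder)

lemma balanced_next:
  assumes st: "consistent S n a st" and acc: "accurate_state S m n a st"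
    and bal: "balanced S m n a st" and a: "a \<ge> 0"
    and i: "i \<in> ucbe_candidates m n st" and j: "j \<in> {1..n} - seen n st i"
  shows "balanced S m n a (ucbe_next S n a i j st)"
  unfolding balanced_def
proof (intro ballI impI)
  let ?st = "ucbe_next S n a i j st"
  fix k p
  assume k: "k \<in> {1..m}" and p: "p \<in> {1..m}" and kp: "k \<noteq> p"
    and pn: "obs_count n ?st p \<noteq> n" and k2: "2 \<le> obs_count n ?st k"
  note count = obs_count_next[OF st j]
  show "1 \<le> obs_count n ?st p \<and>
      row_mean S n p + 4 / 5 * sqrt (a / obs_count n ?st p)
        \<le> row_mean S n k + 6 / 5 * sqrt (a / (real (obs_count n ?st k) - 1))"
  proof (cases "k = i")
    case True
    then have ii: "real (obs_count n ?st i) - 1 = real (obs_count n st i)" and pp: "obs_count n ?st p = obs_count n st p"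
      and c: "obs_count n st i \<ge> 1"
      using count kp k2 by auto
    have "bound st p \<le> bound st i" using i p pn pp by (simp add: candidate_iff)
    \<comment> \<open>The bound of \<open>i\<close> is finite since \<open>i\<close> has been
      observed, hence so is the smaller bound of \<open>p\<close>.\<close>
    then have p1: "obs_count n st p \<ge> 1"
      and le: "obs_mean n st p + sqrt (a / obs_count n st p) \<le> obs_mean n st i + sqrt (a / obs_count n st i)"
      using st c by (auto simp: consistent_def split: if_splits)
    define u v where "u = sqrt (a / obs_count n st p)" and "v = sqrt (a / obs_count n st i)"
    have "\<bar>obs_mean n st p - row_mean S n p\<bar> \<le> 1 / 5 * u" "\<bar>obs_mean n st i - row_mean S n i\<bar> \<le> 1 / 5 * v"
      using obs_mean_accurate[OF st acc p p1 a] obs_mean_accurate[OF st acc k[unfolded True] c a]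
      by (simp_all add: u_def v_def)
    then have "row_mean S n p + 4 / 5 * u \<le> row_mean S n i + 6 / 5 * v"
      using le unfolding u_def[symmetric] v_def[symmetric] by linarith
    then show ?thesis using p1 unfolding True ii pp u_def v_def by blast
  next
    case False
    then have kk: "obs_count n ?st k = obs_count n st k" by (simp add: count)
    \<comment> \<open>A row pulled in this round was not exhausted before it, so the old comparison
      with \<open>p\<close> is available; a larger count of \<open>p\<close> only lowers the left
      side.\<close>
    have "obs_count n st p \<noteq> n"
      using pn i by (cases "p = i") (auto simp: count candidate_iff)
    then have old: "obs_count n st p \<ge> 1"
      "row_mean S n p + 4 / 5 * sqrt (a / obs_count n st p)
        \<le> row_mean S n k + 6 / 5 * sqrt (a / (real (obs_count n st k) - 1))"
      using bal k p kp k2 unfolding kk balanced_def by blast+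
    have ge: "obs_count n st p \<le> obs_count n ?st p" by (simp add: count)
    then have "sqrt (a / obs_count n ?st p) \<le> sqrt (a / obs_count n st p)"
      using old(1) a by (intro real_sqrt_le_mono divide_left_mono) auto
    then show ?thesis using old ge unfolding kk by linarith
  qed
qed

section \<open>Runs from an arbitrary state and their failure probability\<close>

lemma candidates_nonempty:
  assumes st: "consistent S n a st" and lt: "(\<Sum>k\<in>{1..m}. obs_count n st k) < m * n"
  shows "ucbe_candidates m n st \<noteq> {}"
proof -
  let ?P = "{k \<in> {1..m}. obs_count n st k \<noteq> n}"
  have "?P \<noteq> {}"
  proof
    assume "?P = {}"
    then have "(\<Sum>k\<in>{1..m}. obs_count n st k) = (\<Sum>k\<in>{1..m}. n)" by (intro sum.cong) auto
    then show False using lt by simp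
  qed
  then have "Max (bound st ` ?P) \<in> bound st ` ?P" by (intro Max_in) auto
  then obtain i where "i \<in> ?P" "bound st i = Max (bound st ` ?P)" by auto
  then have "i \<in> ucbe_candidates m n st" by (auto simp: candidate_iff)
  then show ?thesis by blast
qed

text \<open>Peels off the first round instead of the last, so that an induction on the remaining
  rounds can start in any state.\<close>

primrec run_from ::
  "(nat \<Rightarrow> nat \<Rightarrow> real) \<Rightarrow> nat \<Rightarrow> nat \<Rightarrow> real \<Rightarrow> nat \<Rightarrow> ucbe_state \<Rightarrow> ucbe_state pmf" where
  "run_from S m n a 0 st = return_pmf st"
| "run_from S m n a (Suc t) st = bind_pmf (ucbe_step S m n a st) (run_from S m n a t)"

lemma run_from_Suc_right:
  "run_from S m n a (Suc t) st = bind_pmf (run_from S m n a t st) (ucbe_step S m n a)"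
proof (induction t arbitrary: st)
  case 0
  have "run_from S m n a 0 = return_pmf" by (rule ext) simp
  then show ?case by (simp add: bind_return_pmf bind_return_pmf')
next
  case (Suc t)
  have "run_from S m n a (Suc (Suc t)) st
      = bind_pmf (ucbe_step S m n a st) (\<lambda>st'. bind_pmf (run_from S m n a t st') (ucbe_step S m n a))"
    using Suc by (metis (no_types, lifting) bind_pmf_cong run_from.simps(2))
  then show ?case by (simp add: bind_assoc_pmf)
qed

lemma ucbe_run_eq_run_from: "ucbe_run S m n a t = run_from S m n a t ucbe_init"
  by (induction t) (simp_all add: run_from_Suc_right del: run_from.simps(2))

definition good_state :: "(nat \<Rightarrow> nat \<Rightarrow> real) \<Rightarrow> nat \<Rightarrow> nat \<Rightarrow> real \<Rightarrow> ucbe_state \<Rightarrow> bool" where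
  "good_state S m n a st \<longleftrightarrow>
     consistent S n a st \<and> accurate_state S m n a st \<and> balanced S m n a st"

text \<open>The summed row potentials bound the failure probability whatever row is selected: the
  selected row pays for its draw with \<open>row_pot_step\<close>, and the potentials of the other
  rows only grow with the number of remaining rounds. The total count is part of the event because
  the final counting argument needs it.\<close>

lemma run_from_failure:
  assumes S: "\<And>i j. i \<in> {1..m} \<Longrightarrow> j \<in> {1..n} \<Longrightarrow> S i j \<in> {0..1}" and a: "a \<ge> 0" and T: "T \<le> m * n"
  shows "good_state S m n a st \<Longrightarrow> (\<Sum>k\<in>{1..m}. obs_count n st k) + t = T \<Longrightarrow>
    measure_pmf.prob (run_from S m n a t st)
        {st'. \<not> (good_state S m n a st' \<and> (\<Sum>k\<in>{1..m}. obs_count n st' k) = T)}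
      \<le> (\<Sum>k\<in>{1..m}. row_pot (S k) {1..n} a t (seen n st k))"
proof (induction t arbitrary: st)
  case 0
  then show ?case by (simp add: sum_nonneg row_pot_nonneg)
next
  case (Suc t)
  let ?Bad = "{st'. \<not> (good_state S m n a st' \<and> (\<Sum>k\<in>{1..m}. obs_count n st' k) = T)}"
  let ?R = "\<lambda>t k. row_pot (S k) {1..n} a t (seen n st k)"
  from Suc.prems have st: "consistent S n a st" and acc: "accurate_state S m n a st"
    and bal: "balanced S m n a st" by (auto simp: good_state_def)
  have run: "run_from S m n a (Suc t) st = bind_pmf (pmf_of_set (ucbe_candidates m n st))
      (\<lambda>i. bind_pmf (pmf_of_set ({1..n} - seen n st i)) (\<lambda>j. run_from S m n a t (ucbe_next S n a i j st)))"
    by (simp add: ucbe_step_def bind_assoc_pmf bind_return_pmf unseen_eq[OF st, simplified])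
  \<comment> \<open>A round remains within the budget, so some row is not exhausted and
    \<open>pmf_of_set\<close> draws from a nonempty finite set.\<close>
  have cand: "finite (ucbe_candidates m n st)" "ucbe_candidates m n st \<noteq> {}"
    using candidates_nonempty[OF st, of m] Suc.prems T
    by (auto simp: candidate_iff intro: finite_subset[of _ "{1..m}"])
  show ?case unfolding run
  proof (rule prob_bind_pmf_le)
    fix i assume "i \<in> set_pmf (pmf_of_set (ucbe_candidates m n st))"
    then have i: "i \<in> ucbe_candidates m n st" using cand by simp
    then have im: "i \<in> {1..m}" and inn: "obs_count n st i \<noteq> n" by (auto simp: candidate_iff)
    define A where "A = seen n st i"
    define U where "U = {1..n} - A"
    define R where "R = (\<Sum>k\<in>{1..m} - {i}. ?R t k)"
    have A: "A \<subseteq> {1..n}" unfolding A_def by (rule seen_subset)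
    have U: "finite U" "U \<noteq> {}"
    proof -
      have "card A \<noteq> n" using inn by (simp add: A_def obs_count_eq_card[OF st])
      then have "A \<noteq> {1..n}" by auto
      then show "finite U" "U \<noteq> {}" using A by (auto simp: U_def)
    qed
    have next_le: "measure_pmf.prob (run_from S m n a t (ucbe_next S n a i j st)) ?Bad
        \<le> of_bool (\<not> accurate (S i) {1..n} a (insert j A)) + row_pot (S i) {1..n} a t (insert j A) + R"
      if j: "j \<in> U" for j
    proof (cases "accurate (S i) {1..n} a (insert j A)")
      case True
      let ?st = "ucbe_next S n a i j st"
      have j': "j \<in> {1..n}" "j \<in> {1..n} - seen n st i" using j by (auto simp: U_def A_def)
      have "accurate_state S m n a ?st"
        using acc True by (simp add: accurate_state_def seen_next[OF j'(1)] A_def)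
      then have "good_state S m n a ?st"
        using consistent_next[OF st j'(1)] balanced_next[OF st acc bal a i j'(2)] by (simp add: good_state_def)
      moreover have "(\<Sum>k\<in>{1..m}. obs_count n ?st k) + t = T"
        using Suc.prems(2) im by (simp add: obs_count_next[OF st j'(2)] sum.remove[of _ i])
      ultimately have "measure_pmf.prob (run_from S m n a t ?st) ?Bad
          \<le> (\<Sum>k\<in>{1..m}. row_pot (S k) {1..n} a t (seen n ?st k))" by (rule Suc.IH)
      also have "\<dots> = row_pot (S i) {1..n} a t (insert j A) + R"
        using im by (simp add: sum.remove[of _ i] seen_next[OF j'(1)] R_def A_def)
      finally show ?thesis using True by simp
    next
      case False
      \<comment> \<open>After a failure nothing is claimed about the rest of the run: the indicator
        alone covers probability one.\<close>
      have "R \<ge> 0" by (simp add: R_def sum_nonneg row_pot_nonneg)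
      moreover have "of_bool (\<not> accurate (S i) {1..n} a (insert j A)) = (1 :: real)" using False by simp
      ultimately show ?thesis
        using row_pot_nonneg[of "S i" "{1..n}" a t "insert j A"]
          measure_pmf.prob_le_1[of "run_from S m n a t (ucbe_next S n a i j st)" ?Bad] by linarith
    qed
    have "measure_pmf.prob (bind_pmf (pmf_of_set U) (\<lambda>j. run_from S m n a t (ucbe_next S n a i j st))) ?Bad
        = (\<Sum>j\<in>U. measure_pmf.prob (run_from S m n a t (ucbe_next S n a i j st)) ?Bad) / card U"
      by (rule prob_bind_pmf_of_set[OF U])
    also have "\<dots> \<le> (\<Sum>j\<in>U. of_bool (\<not> accurate (S i) {1..n} a (insert j A))
        + row_pot (S i) {1..n} a t (insert j A) + R) / card U"
      by (intro divide_right_mono sum_mono next_le) auto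
    also have "\<dots> = (\<Sum>j\<in>U. of_bool (\<not> accurate (S i) {1..n} a (insert j A))
        + row_pot (S i) {1..n} a t (insert j A)) / card U + R"
      using U by (simp add: sum.distrib add_divide_distrib)
    also have "\<dots> \<le> row_pot (S i) {1..n} a (Suc t) A + (\<Sum>k\<in>{1..m} - {i}. ?R (Suc t) k)"
      unfolding R_def U_def using A a S im
      by (intro add_mono row_pot_step sum_mono row_pot_mono) auto
    also have "\<dots> = (\<Sum>k\<in>{1..m}. ?R (Suc t) k)"
      using im by (simp add: sum.remove[of _ i] A_def)
    finally show "measure_pmf.prob (bind_pmf (pmf_of_set ({1..n} - seen n st i))
        (\<lambda>j. run_from S m n a t (ucbe_next S n a i j st))) ?Bad \<le> (\<Sum>k\<in>{1..m}. ?R (Suc t) k)"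
      unfolding U_def A_def .
  qed
qed

lemma seen_init [simp]: "seen n ucbe_init k = {}"
  by (simp add: seen_def ucbe_init_def)

lemma obs_count_init [simp]: "obs_count n ucbe_init k = 0"
  by (simp add: obs_count_def ucbe_init_def)

lemma good_state_init: "good_state S m n a ucbe_init"
  by (simp add: good_state_def accurate_state_def balanced_def accurate_def)
     (simp add: consistent_def, simp add: ucbe_init_def)

text \<open>Initially each of the \<open>m\<close> rows has at most \<open>T\<close> reachable
  counts, each with two tails.\<close>

lemma ucbe_run_failure:
  assumes S: "\<And>i j. i \<in> {1..m} \<Longrightarrow> j \<in> {1..n} \<Longrightarrow> S i j \<in> {0..1}" and a: "a \<ge> 0" and T: "T \<le> m * n"
  shows "measure_pmf.prob (ucbe_run S m n a T)
        {st. \<not> (good_state S m n a st \<and> (\<Sum>k\<in>{1..m}. obs_count n st k) = T)}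
      \<le> 2 * real T * real m * exp (- 2 * a / 25)"
proof -
  have "measure_pmf.prob (ucbe_run S m n a T)
        {st. \<not> (good_state S m n a st \<and> (\<Sum>k\<in>{1..m}. obs_count n st k) = T)}
      \<le> (\<Sum>k\<in>{1..m}. row_pot (S k) {1..n} a T (seen n ucbe_init k))"
    unfolding ucbe_run_eq_run_from using S a T good_state_init by (intro run_from_failure) auto
  also have "\<dots> \<le> (\<Sum>k\<in>{1..m}. real T * (2 * exp (- 2 * a / 25)))"
    unfolding seen_init by (intro sum_mono row_pot_empty a)
  also have "\<dots> = 2 * real T * real m * exp (- 2 * a / 25)" by simp
  finally show ?thesis .
qed

section \<open>From a good final state to the best row\<close>

lemma good_state_best_arm:
  assumes good: "good_state S m n a st" and T: "(\<Sum>k\<in>{1..m}. obs_count n st k) = T"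
    and n: "n \<ge> 1" and mT: "m \<le> T" and a: "a > 0"
    and s: "s \<in> {1..m}" and best: "\<And>k. k \<in> {1..m} \<Longrightarrow> k \<noteq> s \<Longrightarrow> row_mean S n k < row_mean S n s"
    and budget: "36 / 25 * a * hardness S m n s \<le> real T - real m"
    and i: "is_arg_max (obs_mean n st) (\<lambda>k. k \<in> {1..m}) i"
  shows "i = s"
proof (rule ccontr)
  assume "i \<noteq> s"
  have im: "i \<in> {1..m}" and imax: "\<And>k. k \<in> {1..m} \<Longrightarrow> obs_mean n st k \<le> obs_mean n st i"
    using i by (auto simp: is_arg_max_linorder)
  have st: "consistent S n a st" and acc: "accurate_state S m n a st" and bal: "balanced S m n a st"
    using good by (auto simp: good_state_def)
  \<comment> \<open>An unobserved row \<open>p\<close> would, by balance, keep every other row at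
    one pull at most, giving a total of at most \<open>m - 1\<close>. That \<open>n \<ge> 1\<close>
    ensures that count 0 does not mean exhausted.\<close>
  have pos: "obs_count n st p \<ge> 1" if p: "p \<in> {1..m}" for p
  proof (rule ccontr)
    assume "\<not> 1 \<le> obs_count n st p"
    then have p0: "obs_count n st p = 0" by simp
    have "obs_count n st k \<le> 1" if "k \<in> {1..m} - {p}" for k
      using bal that p p0 n unfolding balanced_def by fastforce
    then have "(\<Sum>k\<in>{1..m} - {p}. obs_count n st k) \<le> (\<Sum>k\<in>{1..m} - {p}. 1)"
      by (intro sum_mono) auto
    then have "T \<le> m - 1" using p p0 T by (simp add: sum.remove[of _ p])
    then show False using mT p by auto
  qed
  have "obs_mean n st i < obs_mean n st s"
  proof (rule best_arm_wins[where K = "{1..m}" and c = "obs_count n st" and n = n and a = a and \<mu> = "row_mean S n"])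
    show "row_mean S n p + 4 / 5 * sqrt (a / obs_count n st p)
        \<le> row_mean S n k + 6 / 5 * sqrt (a / (real (obs_count n st k) - 1))"
      if "k \<in> {1..m}" "p \<in> {1..m}" "k \<noteq> p" "obs_count n st p \<noteq> n" "2 \<le> obs_count n st k" for k p
      using bal that unfolding balanced_def by blast
    show "obs_mean n st k = row_mean S n k" if "k \<in> {1..m}" "obs_count n st k = n" for k
    proof -
      have "seen n st k = {1..n}"
        using that seen_subset[of n st k] by (intro card_subset_eq) (auto simp: obs_count_eq_card[OF st])
      then show ?thesis by (simp add: obs_mean_eq[OF st] row_mean_def)
    qed
    have "(\<Sum>k\<in>{1..m}. real (obs_count n st k) - 1) = real T - real m"
      unfolding T[symmetric] by (simp add: sum_subtractf)
    then show "36 / 25 * a * (\<Sum>k\<in>{1..m} - {s}. 1 / (row_mean S n k - row_mean S n s)\<^sup>2)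
        \<le> (\<Sum>k\<in>{1..m}. real (obs_count n st k) - 1)"
      using budget by (simp add: hardness_def)
  qed (use s im \<open>i \<noteq> s\<close> best a pos obs_mean_accurate[OF st acc] in auto)
  then show False using imax[OF s] by simp
qed

theorem corollary1:
  fixes m n T istar :: nat
    and f :: "nat \<Rightarrow> 'x \<Rightarrow> 'y" and x :: "nat \<Rightarrow> 'x" and s :: "'y \<Rightarrow> real"
    and S :: "nat \<Rightarrow> nat \<Rightarrow> real"
    and out :: "ucbe_state \<Rightarrow> nat pmf"
    and a H1 :: real
  assumes "m \<ge> 2" and "n \<ge> 1"
    and "\<forall>i\<in>{1..m}. \<forall>j\<in>{1..n}. S i j = s (f i (x j))"
    and "\<forall>i\<in>{1..m}. \<forall>j\<in>{1..n}. S i j \<in> {0..1}"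
    and "is_arg_max (row_mean S n) (\<lambda>k. k \<in> {1..m}) istar"
    and "\<forall>i. is_arg_max (row_mean S n) (\<lambda>k. k \<in> {1..m}) i \<longrightarrow> i = istar"
    and "H1 = hardness S m n istar"
    and "m \<le> T" and "T \<le> m * n"
    and "a = 25 / 36 * ((real T - real m) / H1)"
    and "ucbe_output_rule m n out"
  shows "measure_pmf.prob (ucbe S m n out T a) {istar}
           \<ge> 1 - 2 * real T * real m * exp (- ((real T - real m) / (18 * H1)))"
proof (cases "T = m")
  case True
  \<comment> \<open>With \<open>T = m\<close> the exponent is zero and the claimed lower bound is
    not positive. In the other case \<open>a\<close> is positive.\<close>
  have "1 \<le> 2 * real T * real m"
    using mult_mono[of 1 "real m" 1 "real m"] True assms(1) by simp
  then have "1 - 2 * real T * real m * exp (- ((real T - real m) / (18 * H1))) \<le> 0"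
    using True by simp
  then show ?thesis using measure_nonneg order_trans by blast
next
  case False
  have star: "istar \<in> {1..m}" using assms(5) by (simp add: is_arg_max_linorder)
  have best: "row_mean S n k < row_mean S n istar" if k: "k \<in> {1..m}" "k \<noteq> istar" for k
  proof (rule ccontr)
    assume "\<not> row_mean S n k < row_mean S n istar"
    then have "is_arg_max (row_mean S n) (\<lambda>k. k \<in> {1..m}) k"
      using assms(5) k(1) by (fastforce simp: is_arg_max_linorder)
    then show False using assms(6) k(2) by blast
  qed
  have H1: "H1 > 0"
    unfolding assms(7) hardness_def
  proof (rule sum_pos)
    have "card ({1..m} - {istar}) > 0" using star assms(1) by simp
    then show "{1..m} - {istar} \<noteq> {}" by (metis card.empty less_irrefl)
  qed (use best in force)+
  have a: "a > 0" using H1 False assms(8) by (simp add: assms(10))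
  \<comment> \<open>The factor 25/36 in \<open>a\<close> cancels 36/25, so the budget is met with
    equality.\<close>
  have budget: "36 / 25 * a * hardness S m n istar \<le> real T - real m"
    using H1 by (simp add: assms(10) assms(7)[symmetric])
  let ?Bad = "{st. \<not> (good_state S m n a st \<and> (\<Sum>k\<in>{1..m}. obs_count n st k) = T)}"
  have "measure_pmf.prob (ucbe S m n out T a) (- {istar}) \<le> measure_pmf.prob (ucbe_run S m n a T) ?Bad"
    unfolding ucbe_def
  proof (rule prob_bind_pmf_le_prob)
    fix st assume "st \<notin> ?Bad"
    \<comment> \<open>In a good state every maximiser of the observed mean is \<open>istar\<close>,
      so any tie-breaking rule returns it.\<close>
    then have "set_pmf (out st) \<subseteq> {istar}"
      using good_state_best_arm[of S m n a st T istar] assms(2,8,11) a star best budget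
      unfolding ucbe_output_rule_def by blast
    then show "measure_pmf.prob (out st) (- {istar}) = 0"
      by (auto simp: measure_pmf_zero_iff)
  qed
  also have "\<dots> \<le> 2 * real T * real m * exp (- 2 * a / 25)"
    using assms(4,9) a by (intro ucbe_run_failure) auto
  \<comment> \<open>The constant 18 arises from \<open>2 / 25 * (25 / 36) = 1 / 18\<close>.\<close>
  also have "- 2 * a / 25 = - ((real T - real m) / (18 * H1))"
    using H1 by (simp add: assms(10) field_simps)
  finally show ?thesis
    using measure_pmf.prob_compl[of "{istar}" "ucbe S m n out T a"] by (simp add: Compl_eq_Diff_UNIV)
qed

end
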